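(* Let $n,m,l\in\mathbb{N}$ with $1\le m\le n-1$ and $m+1\le l\le n-1$, and let $(M_{m,n-l}(t),N_{m,l-m}(t))$ be a Luchko pair of kernels from the subset $T_{n,m,l}\subset L_n$. Then, for the general fractional derivative $D^*_{(N)}$ of Caputo type and the general fractional integral $I_{(M)}$ associated with this pair, the equality $$I_{(M)} D^*_{(N)} X(t) = X(t) - \sum_{k=0}^{n-1} X^{(k)}(0)\, h_{k+1}(t)$$ holds (for $t>0$) for every $X(t)\in C^n_{-1}(0,\infty)$, where $$C^n_{-1}(0,\infty) := \{X:\ X^{(n)}(t)\in C_{-1}(0,\infty)\}.$$
   Context: $C_{-1}(0,\infty)$ is the space of functions $f$ on $(0,\infty)$ that can be represented as $f(t)=t^p g(t)$ for $t>0$ with some $p>-1$ and $g\in C[0,\infty)$. $C_{-1,0}(0,\infty)$ is the space of functions $f$ on $(0,\infty)$ that can be represented as $f(t)=t^p g(t)$ for $t>0$ with some $-1<p<0$ and $g\in C[0,\infty)$. The symbol $*$ denotes the Laplace convolution $(f*g)(t)=\int_0^t f(t-\tau)g(\tau)\,d\tau$, $t>0$. $\{1\}$ is the function identically equal to $1$, and for $n\in\mathbb{N}$, $\{1\}^n$ is its $n$-fold convolution power, $\{1\}^n=h_n(t)=\frac{t^{n-1}}{(n-1)!}$; thus $h_{k+1}(t)=t^k/k!$. $X^{(k)}(0)$ denotes $\lim_{t\to 0+}X^{(k)}(t)$. For $n\in\mathbb{N}$, the Luchko set $L_n$ is the set of pairs $(M(t),N(t))$ (Luchko pairs) with $M,N\in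 C_{-1}(0,\infty)$ such that $(M*N)(t)=\{1\}^n$ for all $t\in(0,\infty)$. A Sonine pair is a pair $(\mu(t),\nu(t))$ with $\mu,\nu\in C_{-1,0}(0,\infty)$ and $(\mu*\nu)(t)=\{1\}$ for all $t\in(0,\infty)$; Sonine pairs belong to $L_1$. $T_m$ is the subset of $L_m$ consisting of the pairs in $L_m$ of the form $(\mu_1*\ldots*\mu_m,\ \nu_1*\ldots*\nu_m)$, where $(\mu_k,\nu_k)$ are Sonine pairs from $L_1$ for all $k=1,\dots,m$. $T_{n,m,l}$ is the subset of $L_n$ consisting of the pairs in $L_n$ of the form $$M_{m,n-l}(t)=(\{1\}^{n-l}*M_m)(t),\quad N_{m,l-m}(t)=(\{1\}^{l-m}*N_m)(t)$$ with $(M_m(t),N_m(t))\in T_m$. For $(M_{m,n-l},N_{m,l-m})\in T_{n,m,l}$: the general fractional integral is $I_{(M)}X(t)=(M_{m,n-l}*X)(t)=\int_0^t M_{m,n-l}(t-\tau)X(\tau)\,d\tau$ for $X\in C_{-1}(0,\infty)$; the general fractional derivative of Caputo type is $D^*_{(N)}X(t)=(N_{m,l-m}*X^{(n)})(t)=\int_0^t N_{m,l-m}(t-\tau)X^{(n)}(\tau)\,d\tau$ for $X\in C^n_{-1}(0,\infty)$. *)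

theory Defs
  imports "HOL-Analysis.Analysis"
begin

text \<open>
  Functions on \<open>(0,\<infinity>)\<close> are total functions \<open>real \<Rightarrow> real\<close> whose values at
  \<open>t \<le> 0\<close> are irrelevant: every condition and every integral below only involves arguments
  \<open>t > 0\<close>, and functions are compared only on \<open>(0,\<infinity>)\<close>.
\<close>

definition C_m1 :: "(real \<Rightarrow> real) set" where
  "C_m1 = {f. \<exists>p g. p > -1 \<and> continuous_on {0..} g \<and> (\<forall>t>0. f t = t powr p * g t)}"

definition C_m1_0 :: "(real \<Rightarrow> real) set" where
  "C_m1_0 = {f. \<exists>p g. -1 < p \<and> p < 0 \<and> continuous_on {0..} g \<and> (\<forall>t>0. f t = t powr p * g t)}"

text \<open>
  The iterated total derivative at \<open>t > 0\<close> depends only on the values of \<open>X\<close> near \<open>t\<close>; its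
  existence on \<open>(0,\<infinity>)\<close> has to be required, since \<^const>\<open>deriv\<close> is total.
\<close>

definition C_m1_deriv :: "nat \<Rightarrow> (real \<Rightarrow> real) set" where
  "C_m1_deriv n = {X. (\<forall>k<n. \<forall>t>0. (deriv ^^ k) X differentiable (at t)) \<and> (deriv ^^ n) X \<in> C_m1}"

definition deriv_at_0 :: "nat \<Rightarrow> (real \<Rightarrow> real) \<Rightarrow> real" where
  "deriv_at_0 k X = Lim (at_right 0) ((deriv ^^ k) X)"

definition laplace_conv :: "(real \<Rightarrow> real) \<Rightarrow> (real \<Rightarrow> real) \<Rightarrow> real \<Rightarrow> real"  (infixl "\<star>" 70) where
  "(f \<star> g) t = (LBINT \<tau>:{0<..<t}. f (t - \<tau>) * g \<tau>)"

text \<open>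
  \<open>\<mu> 1 \<star> \<dots> \<star> \<mu> m\<close>. Convolution has no unit among functions, so the empty product is a dummy
  value; only \<open>m \<ge> 1\<close> is meaningful.
\<close>

fun conv_prod :: "(nat \<Rightarrow> real \<Rightarrow> real) \<Rightarrow> nat \<Rightarrow> real \<Rightarrow> real" where
  "conv_prod \<mu> 0 = (\<lambda>_. 0)"
| "conv_prod \<mu> (Suc 0) = \<mu> 1"
| "conv_prod \<mu> (Suc (Suc m)) = conv_prod \<mu> (Suc m) \<star> \<mu> (Suc (Suc m))"

definition one_pow :: "nat \<Rightarrow> real \<Rightarrow> real" where
  "one_pow n = conv_prod (\<lambda>_ _. 1) n"

definition h :: "nat \<Rightarrow> real \<Rightarrow> real" where
  "h n t = t ^ (n - 1) / fact (n - 1)"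

lemma one_pow_eq_h:
  assumes "n \<ge> 1" and "t > 0"
  shows "one_pow n t = h n t"
proof -
  have "conv_prod (\<lambda>_ _. 1) (Suc k) t = h (Suc k) t" if "t > 0" for k and t :: real
    using that
  proof (induction k arbitrary: t)
    case 0
    show ?case by (simp add: h_def)
  next
    case (Suc k)
    have cont: "continuous_on {0..t} (\<lambda>x. (t - x) ^ k / fact k)"
      by (intro continuous_intros) auto
    have "conv_prod (\<lambda>_ _. 1) (Suc (Suc k)) t = (LBINT x:{0<..<t}. (t - x) ^ k / fact k)"
      unfolding conv_prod.simps laplace_conv_def
      by (intro set_lebesgue_integral_cong) (use Suc.IH in \<open>auto simp: h_def\<close>)
    also have "\<dots> = (LBINT x=0..t. (t - x) ^ k / fact k)"
      using Suc.prems by (simp add: interval_lebesgue_integral_def einterval_def zero_ereal_def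
          greaterThanLessThan_def greaterThan_def lessThan_def Int_def)
    also have "\<dots> = - ((t - t) ^ Suc k / fact (Suc k)) - (- ((t - 0) ^ Suc k / fact (Suc k)))"
      unfolding zero_ereal_def
    proof (rule interval_integral_FTC_finite)
      show "continuous_on {min 0 t..max 0 t} (\<lambda>x. (t - x) ^ k / fact k)"
        using cont Suc.prems by simp
    next
      fix x
      have "((\<lambda>x. - ((t - x) ^ Suc k / fact (Suc k))) has_real_derivative (t - x) ^ k / fact k) (at x)"
        by (rule derivative_eq_intros refl | simp add: divide_simps)+
      then show "((\<lambda>x. - ((t - x) ^ Suc k / fact (Suc k))) has_vector_derivative (t - x) ^ k / fact k)
          (at x within {min 0 t..max 0 t})"
        by (simp add: has_real_derivative_iff_has_vector_derivative has_vector_derivative_at_within)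
    qed
    also have "\<dots> = h (Suc (Suc k)) t" by (simp add: h_def)
    finally show ?case .
  qed
  from this[of t "n - 1"] assms show ?thesis by (simp add: one_pow_def)
qed

definition luchko_pairs :: "nat \<Rightarrow> ((real \<Rightarrow> real) \<times> (real \<Rightarrow> real)) set" where
  "luchko_pairs n = {(M, N). M \<in> C_m1 \<and> N \<in> C_m1 \<and> (\<forall>t>0. (M \<star> N) t = one_pow n t)}"

definition sonine_pairs :: "((real \<Rightarrow> real) \<times> (real \<Rightarrow> real)) set" where
  "sonine_pairs = {(\<mu>, \<nu>). \<mu> \<in> C_m1_0 \<and> \<nu> \<in> C_m1_0 \<and> (\<forall>t>0. (\<mu> \<star> \<nu>) t = 1)}"

definition T_pairs :: "nat \<Rightarrow> ((real \<Rightarrow> real) \<times> (real \<Rightarrow> real)) set" where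
  "T_pairs m = {(M, N). (M, N) \<in> luchko_pairs m \<and>
     (\<exists>\<mu> \<nu>. (\<forall>k\<in>{1..m}. (\<mu> k, \<nu> k) \<in> sonine_pairs) \<and>
        (\<forall>t>0. M t = conv_prod \<mu> m t) \<and> (\<forall>t>0. N t = conv_prod \<nu> m t))}"

definition T_pairs3 :: "nat \<Rightarrow> nat \<Rightarrow> nat \<Rightarrow> ((real \<Rightarrow> real) \<times> (real \<Rightarrow> real)) set" where
  "T_pairs3 n m l = {(M, N). (M, N) \<in> luchko_pairs n \<and>
     (\<exists>M\<^sub>m N\<^sub>m. (M\<^sub>m, N\<^sub>m) \<in> T_pairs m \<and>
        (\<forall>t>0. M t = (one_pow (n - l) \<star> M\<^sub>m) t) \<and> (\<forall>t>0. N t = (one_pow (l - m) \<star> N\<^sub>m) t))}"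

definition GFI :: "(real \<Rightarrow> real) \<Rightarrow> (real \<Rightarrow> real) \<Rightarrow> real \<Rightarrow> real" where
  "GFI M X = M \<star> X"

definition GFD_Caputo :: "nat \<Rightarrow> (real \<Rightarrow> real) \<Rightarrow> (real \<Rightarrow> real) \<Rightarrow> real \<Rightarrow> real" where
  "GFD_Caputo n N X = N \<star> (deriv ^^ n) X"

end

theory Submission imports Defs begin

text \<open>
  Laplace convolution is associative on \<^const>\<open>C_m1\<close>, so with \<open>f = X\<^sup>(\<^sup>n\<^sup>)\<close> the composition
  \<open>M \<star> (N \<star> f)\<close> equals \<open>(M \<star> N) \<star> f\<close>, and by the defining property of a Luchko pair this is
  \<open>{1}\<^sup>n \<star> f\<close>: the \<open>n\<close>-fold integral of \<open>X\<^sup>(\<^sup>n\<^sup>)\<close> starting at \<open>0\<close>. Undoing one derivative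
  after the other produces \<open>X\<close> minus its Taylor polynomial at \<open>0\<close>.

  Two points need analysis, because the functions may be singular at \<open>0\<close>. Associativity
  (\<open>laplace_conv_assoc\<close>) is an interchange of integrals; it has to hold at every \<open>t > 0\<close>, not
  just almost everywhere, so the general theory of convolution in \<open>L\<^sup>1\<close> does not suffice. On
  bounded intervals each factor is dominated by a multiple of a power, and powers convolve to powers by Euler's Beta integral
  (\<open>powr_conv_powr\<close>), which gives absolute integrability for each \<open>t\<close>. Secondly, the fundamental theorem of
  calculus is improper at \<open>0\<close>: an antiderivative on \<open>(0,\<infinity>)\<close> of a function in \<^const>\<open>C_m1\<close>
  has a limit at \<open>0\<close> and is again in \<^const>\<open>C_m1\<close> (\<open>antiderivative_of_C_m1\<close>). Iterating this
  gives both the existence of the initial values \<open>X\<^sup>(\<^sup>k\<^sup>)(0)\<close> and the Taylor formula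
  (\<open>taylor_C_m1_deriv\<close>).
\<close>

section \<open>Laplace convolution as a convolution on the line\<close>

text \<open>
  Extending by zero to the left of \<open>0\<close> turns the Laplace convolution into the ordinary
  convolution over \<open>\<real>\<close>. The domain of integration then no longer depends on \<open>t\<close>, and Fubini's
  theorem and translation invariance apply directly.
\<close>

definition causal :: "(real \<Rightarrow> real) \<Rightarrow> real \<Rightarrow> real" where
  "causal f x = indicator {0<..} x * f x"

lemma laplace_conv_eq_lborel:
  "(f \<star> g) t = (\<integral>\<tau>. causal f (t - \<tau>) * causal g \<tau> \<partial>lborel)"
  unfolding laplace_conv_def set_lebesgue_integral_def
  by (intro Bochner_Integration.integral_cong) (auto simp: causal_def indicator_def)

lemma laplace_conv_cong:
  assumes "\<And>x. x > 0 \<Longrightarrow> f x = f' x" "\<And>x. x > 0 \<Longrightarrow> g x = g' x"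
  shows "f \<star> g = f' \<star> g'"
  unfolding laplace_conv_def fun_eq_iff
  using assms by (auto intro!: set_lebesgue_integral_cong)

lemma causal_laplace_conv: "causal (f \<star> g) = f \<star> g"
proof
  fix t
  have "(f \<star> g) t = 0" if "t \<le> 0"
    using that by (simp add: laplace_conv_def set_lebesgue_integral_def)
  then show "causal (f \<star> g) t = (f \<star> g) t"
    by (cases "t > 0") (auto simp: causal_def)
qed

lemma borel_measurable_causal_powr [measurable]:
  "causal (\<lambda>x. x powr a) \<in> borel_measurable borel"
  unfolding causal_def[abs_def] by measurable

section \<open>Domination by powers and associativity\<close>

text \<open>
  For \<open>t > 0\<close> the substitution \<open>s = t u\<close> reduces the integral to Euler's Beta integral over
  \<open>(0,1)\<close>. The exponent \<open>a + b + 1\<close> exceeds \<open>-1\<close> again, so the rule can be applied repeatedly.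
\<close>

lemma powr_conv_powr:
  assumes "a > -1" "b > -1"
  shows "has_bochner_integral lborel
     (\<lambda>s. causal (\<lambda>x. x powr a) (t - s) * causal (\<lambda>x. x powr b) s)
     (Beta (b + 1) (a + 1) * causal (\<lambda>x. x powr (a + b + 1)) t)"
proof (cases "t > 0")
  case False
  then have "(\<lambda>s. causal (\<lambda>x. x powr a) (t - s) * causal (\<lambda>x. x powr b) s) = (\<lambda>_. 0)"
    by (auto simp: causal_def fun_eq_iff indicator_def)
  moreover have "causal (\<lambda>x. x powr (a + b + 1)) t = 0"
    using False by (simp add: causal_def)
  ultimately show ?thesis
    by (simp add: has_bochner_integral_zero)
next
  case True
  let ?w = "\<lambda>u. causal (\<lambda>x. x powr a) (1 - u) * causal (\<lambda>x. x powr b) u"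
  have "((\<lambda>u. u powr (b + 1 - 1) * (1 - u) powr (a + 1 - 1)) has_integral Beta (b + 1) (a + 1)) {0..1}"
    using assms by (intro has_integral_Beta_real) auto
  then have "(?w has_integral Beta (b + 1) (a + 1)) {0..1}"
    by (rule has_integral_eq[rotated]) (auto simp: causal_def indicator_def)
  then have "(?w has_integral Beta (b + 1) (a + 1)) UNIV"
    by (rule has_integral_on_superset) (auto simp: causal_def indicator_def)
  then have "integral\<^sup>N lborel ?w = ennreal (Beta (b + 1) (a + 1))"
    by (intro nn_integral_has_integral_lborel) (auto simp: causal_def)
  moreover have "Beta (b + 1) (a + 1) \<ge> 0"
    using assms by (simp add: Beta_def)
  ultimately have "has_bochner_integral lborel ?w (Beta (b + 1) (a + 1))"
    by (intro has_bochner_integral_nn_integral) (auto simp: causal_def)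
  then have *: "has_bochner_integral lborel (\<lambda>u. t powr (a + b) * ?w u) (t powr (a + b) * Beta (b + 1) (a + 1))"
    by (rule has_bochner_integral_mult_right)
  have eq: "t powr (a + b) * ?w u = causal (\<lambda>x. x powr a) (t - t * u) * causal (\<lambda>x. x powr b) (t * u)" for u
  proof -
    have "t powr (a + b) * ((1 - u) powr a * u powr b) = (t * (1 - u)) powr a * (t * u) powr b"
      if "0 < u" "u < 1"
      using that True by (simp add: powr_mult powr_add)
    moreover have "t - t * u = t * (1 - u)" by (simp add: algebra_simps)
    ultimately show ?thesis
      using True by (auto simp: causal_def indicator_def zero_less_mult_iff)
  qed
  have "t powr (a + b) * Beta (b + 1) (a + 1)
      = (Beta (b + 1) (a + 1) * causal (\<lambda>x. x powr (a + b + 1)) t) /\<^sub>R \<bar>t\<bar>"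
    using True by (simp add: causal_def powr_add)
  with * eq show ?thesis
    using lborel_has_bochner_integral_real_affine_iff[of t
        "\<lambda>s. causal (\<lambda>x. x powr a) (t - s) * causal (\<lambda>x. x powr b) s"
        "Beta (b + 1) (a + 1) * causal (\<lambda>x. x powr (a + b + 1)) t" 0] True
    by simp
qed

lemma borel_measurable_causal:
  assumes "f \<in> C_m1"
  shows "causal f \<in> borel_measurable borel"
proof -
  obtain p g where g: "continuous_on {0..} g" and f: "\<forall>t>0. f t = t powr p * g t"
    using assms by (auto simp: C_m1_def)
  have "continuous_on {0<..} (\<lambda>x. x powr p * g x)"
    by (intro continuous_intros continuous_on_subset[OF g]) auto
  then have "(\<lambda>x. indicator {0<..} x *\<^sub>R (x powr p * g x)) \<in> borel_measurable borel"
    by (intro borel_measurable_continuous_on_indicator) auto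
  also have "(\<lambda>x. indicator {0<..} x *\<^sub>R (x powr p * g x)) = causal f"
    using f by (auto simp: causal_def fun_eq_iff indicator_def)
  finally show ?thesis .
qed

text \<open>
  On \<open>(0,T]\<close> the continuous factor \<open>g\<close> in \<open>f t = t powr p * g t\<close> is bounded by compactness.
\<close>

lemma causal_le_causal_powr:
  assumes "f \<in> C_m1"
  obtains p C where "p > -1" "\<And>x. x \<le> T \<Longrightarrow> \<bar>causal f x\<bar> \<le> C * causal (\<lambda>x. x powr p) x" "C \<ge> 0"
proof -
  obtain p g where p: "p > -1" and g: "continuous_on {0..} g" and f: "\<forall>t>0. f t = t powr p * g t"
    using assms by (auto simp: C_m1_def)
  have "continuous_on {0..T} g"
    by (rule continuous_on_subset[OF g]) auto
  then have "bounded (g ` {0..T})"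
    by (intro compact_imp_bounded compact_continuous_image) auto
  then obtain C where C: "C > 0" "\<forall>y\<in>g ` {0..T}. norm y \<le> C"
    by (auto simp: bounded_pos)
  show ?thesis
  proof (rule that[OF p])
    fix x assume "x \<le> T"
    then show "\<bar>causal f x\<bar> \<le> C * causal (\<lambda>x. x powr p) x"
      using f C by (auto simp: causal_def indicator_def abs_mult mult.commute intro!: mult_left_mono)
  qed (use C in auto)
qed

lemma laplace_conv_integrable:
  assumes "f \<in> C_m1" "g \<in> C_m1"
  shows "integrable lborel (\<lambda>s. causal f (t - s) * causal g s)"
proof -
  note [measurable] = assms[THEN borel_measurable_causal]
  obtain p C where p: "p > -1" "C \<ge> 0"
    and f: "\<And>x. x \<le> t \<Longrightarrow> \<bar>causal f x\<bar> \<le> C * causal (\<lambda>x. x powr p) x"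
    using causal_le_causal_powr[OF assms(1)] by metis
  obtain q D where q: "q > -1" "D \<ge> 0"
    and g: "\<And>x. x \<le> t \<Longrightarrow> \<bar>causal g x\<bar> \<le> D * causal (\<lambda>x. x powr q) x"
    using causal_le_causal_powr[OF assms(2)] by metis
  show ?thesis
  proof (rule Bochner_Integration.integrable_bound)
    show "integrable lborel (\<lambda>s. (C * D) * (causal (\<lambda>x. x powr p) (t - s) * causal (\<lambda>x. x powr q) s))"
      using powr_conv_powr[OF p(1) q(1)] by (intro integrable_mult_right) (auto dest: integrable.intros)
    have "norm (causal f (t - s) * causal g s)
        \<le> norm (C * D * (causal (\<lambda>x. x powr p) (t - s) * causal (\<lambda>x. x powr q) s))" for s
    proof (cases "0 < s \<and> s < t")
      case True
      have "\<bar>causal f (t - s)\<bar> * \<bar>causal g s\<bar>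
          \<le> (C * causal (\<lambda>x. x powr p) (t - s)) * (D * causal (\<lambda>x. x powr q) s)"
        using True f[of "t - s"] g[of s] by (intro mult_mono) (auto intro: order_trans[OF abs_ge_zero])
      also have "\<dots> = \<bar>C * D * (causal (\<lambda>x. x powr p) (t - s) * causal (\<lambda>x. x powr q) s)\<bar>"
        using p q True by (simp add: abs_mult causal_def)
      finally show ?thesis
        by (simp add: abs_mult)
    qed (auto simp: causal_def)
    then show "AE s in lborel. norm (causal f (t - s) * causal g s)
        \<le> norm (C * D * (causal (\<lambda>x. x powr p) (t - s) * causal (\<lambda>x. x powr q) s))"
      by simp
  qed measurable
qed

text \<open>
  By Fubini's theorem and the translation \<open>\<tau> = s + u\<close>. Only points with \<open>0 < s < \<tau> < t\<close>
  contribute, so all three arguments stay in \<open>(0,t)\<close>, where the factors are dominated by powers;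
  applying the Beta integral twice shows that the dominating function is integrable in the plane.
\<close>

lemma laplace_conv_assoc:
  assumes "f \<in> C_m1" "g \<in> C_m1" "k \<in> C_m1"
  shows "f \<star> (g \<star> k) = (f \<star> g) \<star> k"
proof
  fix t :: real
  note [measurable] = assms[THEN borel_measurable_causal]
  obtain p C where p: "p > -1" "C \<ge> 0"
    and f: "\<And>x. x \<le> t \<Longrightarrow> \<bar>causal f x\<bar> \<le> C * causal (\<lambda>x. x powr p) x"
    using causal_le_causal_powr[OF assms(1)] by metis
  obtain q D where q: "q > -1" "D \<ge> 0"
    and g: "\<And>x. x \<le> t \<Longrightarrow> \<bar>causal g x\<bar> \<le> D * causal (\<lambda>x. x powr q) x"
    using causal_le_causal_powr[OF assms(2)] by metis
  obtain r E where r: "r > -1" "E \<ge> 0"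
    and k: "\<And>x. x \<le> t \<Longrightarrow> \<bar>causal k x\<bar> \<le> E * causal (\<lambda>x. x powr r) x"
    using causal_le_causal_powr[OF assms(3)] by metis
  define P where "P a = causal (\<lambda>x. x powr a)" for a
  have P_nonneg: "P a x \<ge> 0" for a x
    by (simp add: P_def causal_def)
  have P_measurable [measurable]: "P a \<in> borel_measurable borel" for a
    unfolding P_def by measurable
  have PP: "has_bochner_integral lborel (\<lambda>s. P a (t - s) * P b s) (Beta (b + 1) (a + 1) * P (a + b + 1) t)"
    if "a > -1" "b > -1" for a b t
    unfolding P_def by (rule powr_conv_powr[OF that])
  have PPP: "integrable (lborel \<Otimes>\<^sub>M lborel) (\<lambda>(\<tau>, s). P p (t - \<tau>) * (P q (\<tau> - s) * P r s))"
  proof (rule lborel_pair.Fubini_integrable)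
    show "(\<lambda>(\<tau>, s). P p (t - \<tau>) * (P q (\<tau> - s) * P r s)) \<in> borel_measurable (lborel \<Otimes>\<^sub>M lborel)"
      by measurable
    have "(\<integral>s. norm (P p (t - \<tau>) * (P q (\<tau> - s) * P r s)) \<partial>lborel)
        = Beta (r + 1) (q + 1) * (P p (t - \<tau>) * P (q + r + 1) \<tau>)" for \<tau>
      using has_bochner_integral_integral_eq[OF PP[OF q(1) r(1), of \<tau>]]
      by (simp add: P_nonneg)
    moreover have "integrable lborel (\<lambda>\<tau>. P p (t - \<tau>) * P (q + r + 1) \<tau>)"
      using PP[of p "q + r + 1" t] p q r by (auto dest: integrable.intros)
    ultimately show "integrable lborel
        (\<lambda>\<tau>. \<integral>s. norm (case (\<tau>, s) of (\<tau>, s) \<Rightarrow> P p (t - \<tau>) * (P q (\<tau> - s) * P r s)) \<partial>lborel)"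
      by simp
    show "AE \<tau> in lborel. integrable lborel
        (\<lambda>s. case (\<tau>, s) of (\<tau>, s) \<Rightarrow> P p (t - \<tau>) * (P q (\<tau> - s) * P r s))"
      using PP[OF q(1) r(1)] by (auto dest: integrable.intros)
  qed
  have "integrable (lborel \<Otimes>\<^sub>M lborel) (\<lambda>(\<tau>, s). causal f (t - \<tau>) * (causal g (\<tau> - s) * causal k s))"
  proof (rule Bochner_Integration.integrable_bound)
    show "integrable (lborel \<Otimes>\<^sub>M lborel)
        (\<lambda>z. (C * D * E) * (case z of (\<tau>, s) \<Rightarrow> P p (t - \<tau>) * (P q (\<tau> - s) * P r s)))"
      by (intro integrable_mult_right PPP)
    have "\<bar>causal f (t - \<tau>) * (causal g (\<tau> - s) * causal k s)\<bar>
        \<le> \<bar>(C * D * E) * (P p (t - \<tau>) * (P q (\<tau> - s) * P r s))\<bar>" for \<tau> s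
    proof (cases "0 < s \<and> s < \<tau> \<and> \<tau> < t")
      case True
      have "\<bar>causal f (t - \<tau>)\<bar> * (\<bar>causal g (\<tau> - s)\<bar> * \<bar>causal k s\<bar>)
          \<le> (C * P p (t - \<tau>)) * ((D * P q (\<tau> - s)) * (E * P r s))"
        using True f[of "t - \<tau>"] g[of "\<tau> - s"] k[of s] p q r
        unfolding P_def[symmetric]
        by (intro mult_mono mult_nonneg_nonneg P_nonneg abs_ge_zero) auto
      also have "\<dots> = \<bar>(C * D * E) * (P p (t - \<tau>) * (P q (\<tau> - s) * P r s))\<bar>"
        using p q r by (simp add: abs_mult P_nonneg mult_ac)
      finally show ?thesis
        by (simp add: abs_mult)
    qed (auto simp: causal_def)
    then show "AE z in lborel \<Otimes>\<^sub>M lborel.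
        norm (case z of (\<tau>, s) \<Rightarrow> causal f (t - \<tau>) * (causal g (\<tau> - s) * causal k s))
        \<le> norm ((C * D * E) * (case z of (\<tau>, s) \<Rightarrow> P p (t - \<tau>) * (P q (\<tau> - s) * P r s)))"
      by (auto split: prod.split)
  qed measurable
  then have swap: "(\<integral>s. (\<integral>\<tau>. causal f (t - \<tau>) * (causal g (\<tau> - s) * causal k s) \<partial>lborel) \<partial>lborel)
      = (\<integral>\<tau>. (\<integral>s. causal f (t - \<tau>) * (causal g (\<tau> - s) * causal k s) \<partial>lborel) \<partial>lborel)"
    by (rule lborel_pair.Fubini_integral)
  have shift: "(\<integral>\<tau>. causal f (t - \<tau>) * (causal g (\<tau> - s) * causal k s) \<partial>lborel)
      = (f \<star> g) (t - s) * causal k s" for s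
  proof -
    have "(\<integral>\<tau>. causal f (t - \<tau>) * (causal g (\<tau> - s) * causal k s) \<partial>lborel)
        = (\<integral>u. causal f (t - s - u) * causal g u * causal k s \<partial>lborel)"
      by (subst lborel_integral_real_affine[of 1 _ s]) (simp_all add: algebra_simps)
    then show ?thesis
      by (simp add: laplace_conv_eq_lborel)
  qed
  have "(f \<star> (g \<star> k)) t = (\<integral>\<tau>. causal f (t - \<tau>) * (g \<star> k) \<tau> \<partial>lborel)"
    by (simp add: laplace_conv_eq_lborel[of f "g \<star> k"] causal_laplace_conv)
  also have "\<dots> = (\<integral>\<tau>. (\<integral>s. causal f (t - \<tau>) * (causal g (\<tau> - s) * causal k s) \<partial>lborel) \<partial>lborel)"
    by (simp add: laplace_conv_eq_lborel[of g k])
  also have "\<dots> = (\<integral>s. (f \<star> g) (t - s) * causal k s \<partial>lborel)"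
    by (simp only: swap[symmetric] shift)
  also have "\<dots> = ((f \<star> g) \<star> k) t"
    by (simp add: laplace_conv_eq_lborel[of "f \<star> g" k] causal_laplace_conv)
  finally show "(f \<star> (g \<star> k)) t = ((f \<star> g) \<star> k) t" .
qed

section \<open>The Taylor formula with initial values at 0\<close>

lemma C_m1_const: "(\<lambda>_. c) \<in> C_m1"
  unfolding C_m1_def by (auto intro!: exI[of _ 0] exI[of _ "\<lambda>_. c"])

lemma one_pow_in_C_m1:
  assumes "n \<ge> 1"
  shows "one_pow n \<in> C_m1"
proof -
  have "continuous_on {0..} (h n)"
    unfolding h_def[abs_def] by (intro continuous_intros) auto
  with assms show ?thesis
    unfolding C_m1_def by (auto intro!: exI[of _ 0] exI[of _ "h n"] simp: one_pow_eq_h)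
qed

lemma laplace_conv_diff_const:
  assumes "f \<in> C_m1" "g \<in> C_m1"
  shows "(f \<star> (\<lambda>x. g x - c)) t = (f \<star> g) t - c * (f \<star> (\<lambda>_. 1)) t"
proof -
  have "(f \<star> (\<lambda>x. g x - c)) t
      = (\<integral>s. causal f (t - s) * causal g s - c * (causal f (t - s) * causal (\<lambda>_. 1) s) \<partial>lborel)"
    by (simp add: laplace_conv_eq_lborel causal_def algebra_simps)
  also have "\<dots> = (f \<star> g) t - c * (f \<star> (\<lambda>_. 1)) t"
    using assms by (simp add: laplace_conv_eq_lborel laplace_conv_integrable C_m1_const)
  finally show ?thesis .
qed

text \<open>
  Functions in \<^const>\<open>C_m1\<close> are integrable up to \<open>0\<close>, so \<open>Z t = \<integral>\<^sub>0\<^sup>t f\<close> is defined and continuous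
  on \<open>[0,\<infinity>)\<close> with \<open>Z 0 = 0\<close>. Away from \<open>0\<close> the fundamental theorem of calculus shows that
  \<open>Y - Z\<close> is constant, and this constant is the limit of \<open>Y\<close> at \<open>0\<close>. As \<open>Z\<close> is continuous up to
  \<open>0\<close>, the exponent \<open>p = 0\<close> witnesses that \<open>Y\<close> lies in \<^const>\<open>C_m1\<close>.
\<close>

lemma antiderivative_of_C_m1:
  assumes f: "f \<in> C_m1" and Y: "\<forall>t>0. (Y has_real_derivative f t) (at t)"
  shows "Y \<in> C_m1"
    and "\<exists>c. (Y \<longlongrightarrow> c) (at_right 0) \<and> (\<forall>t>0. ((\<lambda>_. 1) \<star> f) t = Y t - c)"
proof -
  define Z where "Z t = integral {0..t} (causal f)" for t
  have L: "(causal f has_integral ((\<lambda>_. 1) \<star> f) t) {0..t}" for t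
  proof -
    have "integrable lborel (\<lambda>s. causal (\<lambda>_. 1) (t - s) * causal f s)"
      by (rule laplace_conv_integrable[OF C_m1_const f])
    then have "((\<lambda>s. causal (\<lambda>_. 1) (t - s) * causal f s) has_integral ((\<lambda>_. 1) \<star> f) t) UNIV"
      unfolding laplace_conv_eq_lborel by (rule has_integral_integral_lborel)
    also have "(\<lambda>s. causal (\<lambda>_. 1) (t - s) * causal f s) = (\<lambda>s. if s \<in> {0<..<t} then causal f s else 0)"
      by (auto simp: causal_def fun_eq_iff)
    finally have "(causal f has_integral ((\<lambda>_. 1) \<star> f) t) {0<..<t}"
      by (simp only: has_integral_restrict_UNIV)
    then show ?thesis
      using has_integral_Icc_iff_Ioo by blast
  qed
  have ZL: "Z t = ((\<lambda>_. 1) \<star> f) t" for t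
    unfolding Z_def by (rule integral_unique[OF L])
  have Z_cont: "continuous_on {0..} Z"
    unfolding continuous_on_eq_continuous_within
  proof
    fix x :: real assume "x \<in> {0..}"
    have "continuous_on {0..x + 1} Z"
      unfolding Z_def[abs_def] by (rule indefinite_integral_continuous_1) (use L in blast)
    then have "continuous (at x within {0..x + 1}) Z"
      using \<open>x \<in> {0..}\<close> by (simp add: continuous_on_eq_continuous_within)
    moreover have "at x within {0..x + 1} = at x within {0..}"
      by (rule at_within_nhd[of _ "{..<x + 1}"]) auto
    ultimately show "continuous (at x within {0..}) Z" by simp
  qed
  have diff: "Y t - Z t = Y s - Z s" if "0 < s" "s \<le> t" for s t
  proof -
    have "(f has_integral (Y t - Y s)) {s..t}"
      using that Y by (intro fundamental_theorem_of_calculus)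
        (auto simp: has_real_derivative_iff_has_vector_derivative[symmetric]
          intro!: has_field_derivative_at_within Y[rule_format])
    then have "(causal f has_integral (Y t - Y s)) {s..t}"
      by (rule has_integral_eq[rotated]) (use that in \<open>auto simp: causal_def\<close>)
    then have "integral {s..t} (causal f) = Y t - Y s"
      by (rule integral_unique)
    moreover have "integral {0..s} (causal f) + integral {s..t} (causal f) = integral {0..t} (causal f)"
      using that L by (intro Henstock_Kurzweil_Integration.integral_combine) auto
    ultimately show ?thesis by (simp add: Z_def)
  qed
  define c where "c = Y 1 - Z 1"
  have YZ: "Y t = Z t + c" if "t > 0" for t
    using diff[of 1 t] diff[of t 1] that by (cases "t \<ge> 1") (auto simp: c_def)
  have "(Z \<longlongrightarrow> Z 0) (at 0 within {0..})"
    using Z_cont by (auto simp: continuous_on_def)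
  then have "(Z \<longlongrightarrow> 0) (at_right 0)"
    by (rule tendsto_within_subset[THEN tendsto_eq_rhs]) (auto simp: Z_def)
  then have "((\<lambda>t. Z t + c) \<longlongrightarrow> c) (at_right 0)"
    by (auto intro!: tendsto_eq_intros)
  then have "(Y \<longlongrightarrow> c) (at_right 0)"
    by (rule Lim_transform_eventually) (auto simp: eventually_at_filter YZ)
  then show "\<exists>c. (Y \<longlongrightarrow> c) (at_right 0) \<and> (\<forall>t>0. ((\<lambda>_. 1) \<star> f) t = Y t - c)"
    using YZ ZL by (intro exI[of _ c]) simp
  show "Y \<in> C_m1"
    unfolding C_m1_def using Z_cont YZ
    by (auto intro!: exI[of _ 0] exI[of _ "\<lambda>t. Z t + c"] continuous_intros)
qed

text \<open>
  Induction on \<open>n\<close>: writing \<open>{1}\<^sup>n\<^sup>+\<^sup>1 = {1}\<^sup>n \<star> {1}\<close> and moving the last factor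
  \<open>{1}\<close> onto \<open>X\<^sup>(\<^sup>n\<^sup>+\<^sup>1\<^sup>)\<close> integrates once, giving \<open>X\<^sup>(\<^sup>n\<^sup>) - X\<^sup>(\<^sup>n\<^sup>)(0)\<close>; the constant contributes
  the new Taylor term \<open>X\<^sup>(\<^sup>n\<^sup>)(0) {1}\<^sup>n\<^sup>+\<^sup>1\<close>. The induction hypothesis applies to the rest because
  \<open>X\<^sup>(\<^sup>n\<^sup>)\<close> is again in \<^const>\<open>C_m1\<close>. The lowest order is \<open>1\<close>, since convolution has no unit.
\<close>

lemma taylor_C_m1_deriv:
  assumes "X \<in> C_m1_deriv (Suc n)"
  shows "\<forall>k<Suc n. ((deriv ^^ k) X \<longlongrightarrow> deriv_at_0 k X) (at_right 0)"
    and "\<forall>t>0. (one_pow (Suc n) \<star> (deriv ^^ Suc n) X) t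
      = X t - (\<Sum>k<Suc n. deriv_at_0 k X * h (k + 1) t)"
proof -
  have step: "((deriv ^^ n) X \<longlongrightarrow> deriv_at_0 n X) (at_right 0) \<and> (deriv ^^ n) X \<in> C_m1 \<and>
     (\<forall>t>0. ((\<lambda>_. 1) \<star> (deriv ^^ Suc n) X) t = (deriv ^^ n) X t - deriv_at_0 n X)"
    if X: "X \<in> C_m1_deriv (Suc n)" for n
  proof -
    have Y: "\<forall>t>0. ((deriv ^^ n) X has_real_derivative (deriv ^^ Suc n) X t) (at t)"
      using X by (auto simp: C_m1_deriv_def DERIV_deriv_iff_real_differentiable)
    have f: "(deriv ^^ Suc n) X \<in> C_m1"
      using X by (simp add: C_m1_deriv_def)
    obtain c where c: "((deriv ^^ n) X \<longlongrightarrow> c) (at_right 0)"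
      "\<forall>t>0. ((\<lambda>_. 1) \<star> (deriv ^^ Suc n) X) t = (deriv ^^ n) X t - c"
      using antiderivative_of_C_m1(2)[OF f Y] by (elim exE conjE)
    have "deriv_at_0 n X = c"
      unfolding deriv_at_0_def by (rule tendsto_Lim[OF _ c(1)]) simp
    with c antiderivative_of_C_m1(1)[OF f Y] show ?thesis by (simp del: funpow.simps)
  qed
  have "(\<forall>k<Suc n. ((deriv ^^ k) X \<longlongrightarrow> deriv_at_0 k X) (at_right 0)) \<and>
      (\<forall>t>0. (one_pow (Suc n) \<star> (deriv ^^ Suc n) X) t
        = X t - (\<Sum>k<Suc n. deriv_at_0 k X * h (k + 1) t))"
    using assms
  proof (induction n)
    case 0
    have "one_pow (Suc 0) = (\<lambda>_. 1)"
      by (simp add: one_pow_def)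
    with step[OF 0] show ?case
      by (simp add: h_def)
  next
    case (Suc n)
    let ?f = "(deriv ^^ Suc (Suc n)) X" and ?g = "(deriv ^^ Suc n) X" and ?c = "deriv_at_0 (Suc n) X"
    note st = step[OF Suc.prems]
    have f: "?f \<in> C_m1"
      using Suc.prems by (simp add: C_m1_deriv_def)
    have "X \<in> C_m1_deriv (Suc n)"
      using Suc.prems st by (simp add: C_m1_deriv_def)
    note IH = Suc.IH[OF this]
    have one_pow_Suc: "one_pow (Suc (Suc n)) = one_pow (Suc n) \<star> (\<lambda>_. 1)"
      by (simp add: one_pow_def)
    have "(one_pow (Suc (Suc n)) \<star> ?f) t
        = X t - (\<Sum>k<Suc (Suc n). deriv_at_0 k X * h (k + 1) t)" if t: "t > 0" for t
    proof -
      have "one_pow (Suc (Suc n)) \<star> ?f = one_pow (Suc n) \<star> ((\<lambda>_. 1) \<star> ?f)"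
        unfolding one_pow_Suc using laplace_conv_assoc[OF one_pow_in_C_m1 C_m1_const f] by simp
      also have "\<dots> = one_pow (Suc n) \<star> (\<lambda>x. ?g x - ?c)"
        by (rule laplace_conv_cong) (use st in auto)
      finally have "(one_pow (Suc (Suc n)) \<star> ?f) t
          = (one_pow (Suc n) \<star> ?g) t - ?c * one_pow (Suc (Suc n)) t"
        using st laplace_conv_diff_const[of "one_pow (Suc n)" ?g ?c t]
        by (simp add: one_pow_in_C_m1 one_pow_Suc)
      then show ?thesis
        using IH t by (simp add: one_pow_eq_h)
    qed
    then show ?case
      using IH st by (auto simp: less_Suc_eq)
  qed
  then show "\<forall>k<Suc n. ((deriv ^^ k) X \<longlongrightarrow> deriv_at_0 k X) (at_right 0)"
    and "\<forall>t>0. (one_pow (Suc n) \<star> (deriv ^^ Suc n) X) t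
      = X t - (\<Sum>k<Suc n. deriv_at_0 k X * h (k + 1) t)"
    by blast+
qed

theorem theorem7:
  fixes n m l :: nat and M N X :: "real \<Rightarrow> real"
  assumes "1 \<le> m" and "m \<le> n - 1"
    and "m + 1 \<le> l" and "l \<le> n - 1"
    and "(M, N) \<in> T_pairs3 n m l"
    and "X \<in> C_m1_deriv n"
  shows "(\<forall>k<n. \<exists>c. ((deriv ^^ k) X \<longlongrightarrow> c) (at_right 0)) \<and>
    (\<forall>t>0. GFI M (GFD_Caputo n N X) t = X t - (\<Sum>k=0..n-1. deriv_at_0 k X * h (k + 1) t))"
proof -
  obtain n' where n: "n = Suc n'"
    using assms(1,2) by (cases n) auto
  have MN: "M \<in> C_m1" "N \<in> C_m1" "\<forall>t>0. (M \<star> N) t = one_pow n t"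
    using assms(5) by (auto simp: T_pairs3_def luchko_pairs_def)
  have "GFI M (GFD_Caputo n N X) = (M \<star> N) \<star> (deriv ^^ n) X"
    unfolding GFI_def GFD_Caputo_def
    using assms(6) MN by (intro laplace_conv_assoc) (auto simp: C_m1_deriv_def)
  also have "\<dots> = one_pow n \<star> (deriv ^^ n) X"
    by (rule laplace_conv_cong) (use MN in auto)
  finally have "GFI M (GFD_Caputo n N X) = one_pow n \<star> (deriv ^^ n) X" .
  moreover have "{0..n - 1} = {..<n}"
    using n by auto
  ultimately show ?thesis
    using taylor_C_m1_deriv[of X n'] assms(6) by (auto simp: n)
qed

end
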